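(* Let $G$ be a locally compact Hausdorff group with left Haar measure $\mu$, let $1\leqslant p<\infty$, and let $\mathcal{F}\subset L^p(G)$ be $L^p$-equicontinuous. If $\phi\in C_c(G)$, then the family $\mathcal{F}\star\phi:=\{f\star\phi : f\in\mathcal{F}\}$ is equicontinuous, i.e. for every $x_*\in G$ and $\varepsilon>0$ there exists an open neighbourhood $U$ of $x_*$ such that $|f\star\phi(x)-f\star\phi(x_* )|\leqslant\varepsilon$ for all $x\in U$ and $f\in\mathcal{F}$.
   Context: $\mu$ is a left Haar measure on $G$: a nonzero left-invariant Borel measure, finite on compact sets, inner regular on open sets and outer regular on measurable sets; $dy$ denotes integration with respect to $\mu$. $L^p(G)=L^p(G,\mu)$ (complex-valued functions) with norm $\|\cdot\|_p$. For $x\in G$, $L_xf(y):=f(xy)$ and $R_xf(y):=f(yx)$. A family $\mathcal{F}\subset L^p(G)$ is $L^p$-equicontinuous if for every $\varepsilon>0$ there exists an open neighbourhood $U_e$ of the neutral element $e$ such that for all $f\in\mathcal{F}$: $\sup_{x\in U_e}\|L_xf-f\|_p\leqslant\varepsilon$ and $\sup_{x\in U_e}\|R_xf-f\|_p\leqslant\varepsilon$. $C_c(G)$ is the space of continuous complex-valued functions with compact support. Convolution: $f\star\phi(x)=\int_G f(y)\,\phi(y^{-1}x)\,dy$ for $x\in G$. *)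

theory Defs
  imports "HOL-Analysis.Analysis"
begin

text \<open>
  Groups are written additively, because the library's type class of topological groups is
  \<open>topological_group_add\<close>. That class does not assume commutativity, so the product $xy$ is
  \<open>x + y\<close>, the inverse $y^{-1}$ is \<open>- y\<close> and the neutral element $e$ is \<open>0\<close>; the order of
  summands matters throughout.
\<close>

definition left_haar_measure :: "'a::{topological_group_add,t2_space} measure \<Rightarrow> bool" where
  "left_haar_measure M \<longleftrightarrow>
     sets M = sets borel \<and>
     emeasure M UNIV \<noteq> 0 \<and>
     (\<forall>a. \<forall>A\<in>sets M. emeasure M ((\<lambda>y. a + y) ` A) = emeasure M A) \<and>
     (\<forall>K. compact K \<longrightarrow> emeasure M K < \<infinity>) \<and>
     (\<forall>U. open U \<longrightarrow> emeasure M U = (SUP K\<in>{K. compact K \<and> K \<subseteq> U}. emeasure M K)) \<and>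
     (\<forall>A\<in>sets M. emeasure M A = (INF U\<in>{U. open U \<and> A \<subseteq> U}. emeasure M U))"

text \<open>
  The norm takes values in \<open>ennreal\<close>, so that functions of infinite norm do not get a junk real
  value. As \<open>powr\<close> is a real operation, the value \<open>\<infinity>\<close> is treated separately.
\<close>

definition Lp_norm :: "'a measure \<Rightarrow> real \<Rightarrow> ('a \<Rightarrow> complex) \<Rightarrow> ennreal" where
  "Lp_norm M p f =
     (let I = (\<integral>\<^sup>+ y. ennreal (cmod (f y) powr p) \<partial>M)
      in if I = \<infinity> then \<infinity> else ennreal (enn2real I powr (1 / p)))"

text \<open>
  Elements of $L^p$ are represented by functions; the notions below do not depend on the choice
  of representatives modulo null sets of a left Haar measure.
\<close>

definition Lp_functions :: "'a measure \<Rightarrow> real \<Rightarrow> ('a \<Rightarrow> complex) set" where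
  "Lp_functions M p = {f \<in> borel_measurable M. Lp_norm M p f < \<infinity>}"

definition left_translate :: "'a::plus \<Rightarrow> ('a \<Rightarrow> complex) \<Rightarrow> 'a \<Rightarrow> complex" where
  "left_translate x f = (\<lambda>y. f (x + y))"

definition right_translate :: "'a::plus \<Rightarrow> ('a \<Rightarrow> complex) \<Rightarrow> 'a \<Rightarrow> complex" where
  "right_translate x f = (\<lambda>y. f (y + x))"

definition Lp_equicontinuous ::
  "'a::topological_group_add measure \<Rightarrow> real \<Rightarrow> ('a \<Rightarrow> complex) set \<Rightarrow> bool" where
  "Lp_equicontinuous M p F \<longleftrightarrow>
     (\<forall>\<epsilon>::real. \<epsilon> > 0 \<longrightarrow>
        (\<exists>U. open U \<and> 0 \<in> U \<and>
           (\<forall>f\<in>F.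
              (SUP x\<in>U. Lp_norm M p (\<lambda>y. left_translate x f y - f y)) \<le> ennreal \<epsilon> \<and>
              (SUP x\<in>U. Lp_norm M p (\<lambda>y. right_translate x f y - f y)) \<le> ennreal \<epsilon>)))"

definition Cc_functions :: "('a::topological_space \<Rightarrow> complex) set" where
  "Cc_functions = {f. continuous_on UNIV f \<and> compact (closure {x. f x \<noteq> 0})}"

definition group_convolution ::
  "'a::group_add measure \<Rightarrow> ('a \<Rightarrow> complex) \<Rightarrow> ('a \<Rightarrow> complex) \<Rightarrow> 'a \<Rightarrow> complex" where
  "group_convolution M f \<phi> = (\<lambda>x. LINT y|M. f y * \<phi> (- y + x))"

definition equicontinuous_family :: "('a::topological_space \<Rightarrow> complex) set \<Rightarrow> bool" where
  "equicontinuous_family H \<longleftrightarrow>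
     (\<forall>x0. \<forall>\<epsilon>::real. \<epsilon> > 0 \<longrightarrow>
        (\<exists>U. open U \<and> x0 \<in> U \<and> (\<forall>x\<in>U. \<forall>h\<in>H. cmod (h x - h x0) \<le> \<epsilon>)))"

end

theory Submission
  imports Defs
begin

text \<open>
  The substitution \<open>y \<mapsto> (x - x0) + y\<close>, which preserves a left Haar measure, moves the dependence
  of $(f \star \phi)(x)$ on \<open>x\<close> from $\phi$ to \<open>f\<close>: with \<open>z = x - x0\<close>,
  \[ (f \star \phi)(x) - (f \star \phi)(x_0) = \int (L_z f - f)(y)\, \phi(-y + x_0)\, dy . \]
  The second factor is now a fixed bounded function with compact support, while equicontinuity
  makes $\|L_z f - f\|_p$ small, uniformly in \<open>f\<close>, as soon as \<open>z\<close> is close to the neutral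
  element, that is, \<open>x\<close> is close to \<open>x0\<close>. What remains is to bound the integral of $g\psi$ by a
  constant times $\|g\|_p$ when $\psi$ is bounded and vanishes off a set of finite measure
  (\<open>nn_integral_mult_le_Lp_norm\<close>). The same bound shows that all the integrals exist, so that the
  difference of the two convolutions really is the integral of the difference.
\<close>

section \<open>Integrating an \<open>L\<^sup>p\<close> function against a bounded function on a set of finite measure\<close>

lemma nn_integral_powr_le_of_Lp_norm_le:
  assumes "0 < p" "0 \<le> \<delta>" "Lp_norm M p g \<le> ennreal \<delta>"
  shows "(\<integral>\<^sup>+ y. ennreal (cmod (g y) powr p) \<partial>M) \<le> ennreal (\<delta> powr p)"
proof -
  define I where "I = (\<integral>\<^sup>+ y. ennreal (cmod (g y) powr p) \<partial>M)"
  have fin: "I \<noteq> \<infinity>"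
    using assms(3) by (auto simp: Lp_norm_def I_def[symmetric] Let_def top_unique split: if_splits)
  then have "ennreal (enn2real I powr (1 / p)) \<le> ennreal \<delta>"
    using assms(3) by (simp add: Lp_norm_def I_def[symmetric] Let_def)
  then have "enn2real I powr (1 / p) \<le> \<delta>"
    using assms(2) by simp
  then have "(enn2real I powr (1 / p)) powr p \<le> \<delta> powr p"
    using assms(1) by (intro powr_mono2) auto
  then have "enn2real I \<le> \<delta> powr p"
    using assms(1) by (simp add: powr_powr)
  then show ?thesis
    using fin unfolding I_def[symmetric]
    by (metis ennreal_enn2real_if ennreal_leI infinity_ennreal_def)
qed

text \<open>
  Below the threshold \<open>t\<close> the first summand suffices; above it, $a = a^{1-p} a^p \le t^{1-p} a^p$.
  Integrated with \<open>t\<close> equal to the norm, this elementary splitting replaces Hoelder's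
  inequality and treats all exponents alike, including \<open>p = 1\<close>.
\<close>

lemma le_threshold_plus_powr:
  fixes a t p :: real
  assumes "0 \<le> a" "0 < t" "1 \<le> p"
  shows "a \<le> t + t powr (1 - p) * a powr p"
proof (cases "a \<le> t")
  case True
  then show ?thesis by (simp add: add_increasing2)
next
  case False
  then have "a = a powr (1 - p) * a powr p"
    using assms by (simp flip: powr_add)
  also have "\<dots> \<le> t powr (1 - p) * a powr p"
    using False assms by (intro mult_right_mono powr_mono2') auto
  finally show ?thesis using assms by linarith
qed

lemma nn_integral_mult_le_Lp_norm:
  fixes g \<psi> :: "'a \<Rightarrow> complex"
  assumes p: "1 \<le> p" and \<delta>: "0 < \<delta>" and B: "0 \<le> B"
    and g[measurable]: "g \<in> borel_measurable M" and K[measurable]: "K \<in> sets M"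
    and norm: "Lp_norm M p g \<le> ennreal \<delta>"
    and bd: "\<And>y. cmod (\<psi> y) \<le> B" and off: "\<And>y. y \<notin> K \<Longrightarrow> \<psi> y = 0"
  shows "(\<integral>\<^sup>+ y. ennreal (cmod (g y * \<psi> y)) \<partial>M) \<le> ennreal (B * \<delta>) * (emeasure M K + 1)"
proof -
  define c where "c = B * \<delta> powr (1 - p)"
  have c: "0 \<le> c" using B by (simp add: c_def)
  have pointwise: "ennreal (cmod (g y * \<psi> y))
      \<le> ennreal (B * \<delta>) * indicator K y + ennreal c * ennreal (cmod (g y) powr p)" for y
  proof (cases "y \<in> K")
    case True
    have "cmod (g y * \<psi> y) \<le> cmod (g y) * B"
      by (simp add: norm_mult mult_left_mono bd)
    also have "\<dots> \<le> (\<delta> + \<delta> powr (1 - p) * cmod (g y) powr p) * B"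
      using le_threshold_plus_powr[OF _ \<delta> p] B by (intro mult_right_mono) auto
    also have "\<dots> = B * \<delta> + c * cmod (g y) powr p"
      by (simp add: c_def algebra_simps)
    finally show ?thesis
      using True c B \<delta> by (simp flip: ennreal_plus ennreal_mult)
  qed (simp add: off)
  have "(\<integral>\<^sup>+ y. ennreal (cmod (g y * \<psi> y)) \<partial>M)
      \<le> (\<integral>\<^sup>+ y. ennreal (B * \<delta>) * indicator K y + ennreal c * ennreal (cmod (g y) powr p) \<partial>M)"
    by (intro nn_integral_mono pointwise)
  also have "\<dots> = ennreal (B * \<delta>) * emeasure M K
      + ennreal c * (\<integral>\<^sup>+ y. ennreal (cmod (g y) powr p) \<partial>M)"
    by (simp add: nn_integral_add nn_integral_cmult nn_integral_cmult_indicator)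
  also have "\<dots> \<le> ennreal (B * \<delta>) * emeasure M K + ennreal c * ennreal (\<delta> powr p)"
    using nn_integral_powr_le_of_Lp_norm_le[OF _ _ norm] p \<delta>
    by (intro add_left_mono mult_left_mono) auto
  also have "ennreal c * ennreal (\<delta> powr p) = ennreal (B * \<delta>)"
    using c \<delta> by (simp add: c_def mult.assoc flip: ennreal_mult powr_add)
  finally show ?thesis by (simp add: distrib_left)
qed

lemma integrable_mult_of_Lp_norm_finite:
  fixes g \<psi> :: "'a \<Rightarrow> complex"
  assumes p: "1 \<le> p" and B: "0 \<le> B"
    and g[measurable]: "g \<in> borel_measurable M" and \<psi>[measurable]: "\<psi> \<in> borel_measurable M"
    and K: "K \<in> sets M" "emeasure M K < \<infinity>"
    and norm: "Lp_norm M p g < \<infinity>"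
    and bd: "\<And>y. cmod (\<psi> y) \<le> B" and off: "\<And>y. y \<notin> K \<Longrightarrow> \<psi> y = 0"
  shows "integrable M (\<lambda>y. g y * \<psi> y)"
proof -
  \<comment> \<open>The added 1 makes the bound positive even when the norm vanishes.\<close>
  define \<delta> where "\<delta> = enn2real (Lp_norm M p g) + 1"
  have "Lp_norm M p g = ennreal (enn2real (Lp_norm M p g))"
    using norm by (simp add: less_top)
  also have "\<dots> \<le> ennreal \<delta>"
    by (intro ennreal_leI) (simp add: \<delta>_def)
  finally have "Lp_norm M p g \<le> ennreal \<delta>" .
  then have "(\<integral>\<^sup>+ y. ennreal (cmod (g y * \<psi> y)) \<partial>M) \<le> ennreal (B * \<delta>) * (emeasure M K + 1)"
    using p B bd off K(1)
    by (intro nn_integral_mult_le_Lp_norm) (auto simp: \<delta>_def add_nonneg_pos)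
  also have "\<dots> < \<infinity>"
    using K(2) by (simp add: ennreal_mult_less_top)
  finally show ?thesis
    by (intro integrableI_bounded) auto
qed

section \<open>Left translation and reflected test functions\<close>

lemma borel_measurable_left_haar_iff:
  "left_haar_measure M \<Longrightarrow> f \<in> borel_measurable M \<longleftrightarrow> f \<in> borel_measurable borel"
  by (simp add: left_haar_measure_def cong: measurable_cong_sets)

lemma measurable_left_add:
  assumes "left_haar_measure (M :: 'a::{topological_group_add,t2_space} measure)"
  shows "(\<lambda>y. a + y) \<in> measurable M M"
proof -
  have "(\<lambda>y::'a. a + y) \<in> borel_measurable borel"
    by (intro borel_measurable_continuous_onI continuous_intros)
  moreover have "sets M = sets borel"
    using assms by (simp add: left_haar_measure_def)
  ultimately show ?thesis
    by (simp cong: measurable_cong_sets)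
qed

lemma distr_left_add:
  assumes M: "left_haar_measure (M :: 'a::{topological_group_add,t2_space} measure)"
  shows "distr M M (\<lambda>y. a + y) = M"
proof (rule measure_eqI)
  fix A assume "A \<in> sets (distr M M (\<lambda>y. a + y))"
  then have A: "A \<in> sets M" by simp
  have sp: "space M = UNIV"
    using M sets_eq_imp_space_eq[of M borel] by (simp add: left_haar_measure_def)
  have "(\<lambda>y. a + y) -` A = (\<lambda>y. - a + y) ` A"
    by (force simp: image_iff add.assoc[symmetric] intro: bexI[of _ "a + _"])
  then show "emeasure (distr M M (\<lambda>y. a + y)) A = emeasure M A"
    using M A by (simp add: emeasure_distr[OF measurable_left_add[OF M]] sp)
      (simp add: left_haar_measure_def)
qed simp

lemma Cc_function_bounded:
  assumes "\<phi> \<in> Cc_functions"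
  obtains B where "0 \<le> B" "\<And>y. cmod (\<phi> y) \<le> B"
proof -
  let ?K = "closure {x. \<phi> x \<noteq> 0}"
  have "compact (\<phi> ` ?K)"
    using assms by (intro compact_continuous_image) (auto simp: Cc_functions_def
        intro: continuous_on_subset)
  then obtain B where B: "0 < B" "\<forall>z\<in>\<phi> ` ?K. cmod z \<le> B"
    using compact_imp_bounded bounded_pos by metis
  have "cmod (\<phi> y) \<le> B" for y
    using B closure_subset[of "{x. \<phi> x \<noteq> 0}"] by (cases "\<phi> y = 0") auto
  then show thesis using that[of B] B(1) by simp
qed

lemma Cc_function_reflected_support:
  fixes \<phi> :: "'a::{topological_group_add,t2_space} \<Rightarrow> complex"
  assumes "\<phi> \<in> Cc_functions"
  obtains K where "compact K" "\<And>y. y \<notin> K \<Longrightarrow> \<phi> (- y + x) = 0"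
proof
  let ?S = "closure {x. \<phi> x \<noteq> 0}"
  show "compact ((\<lambda>k. x - k) ` ?S)"
    using assms by (intro compact_continuous_image continuous_intros) (simp add: Cc_functions_def)
  fix y assume y: "y \<notin> (\<lambda>k. x - k) ` ?S"
  have "y = x - (- y + x)"
    by (simp add: diff_conv_add_uminus minus_add add.assoc[symmetric] del: add_uminus_conv_diff)
  then have "- y + x \<notin> ?S" using y by blast
  then show "\<phi> (- y + x) = 0" using closure_subset[of "{x. \<phi> x \<noteq> 0}"] by blast
qed

lemma borel_measurable_reflected:
  fixes \<phi> :: "'a::{topological_group_add,t2_space} \<Rightarrow> complex"
  assumes "left_haar_measure M" "\<phi> \<in> Cc_functions"
  shows "(\<lambda>y. \<phi> (- y + x)) \<in> borel_measurable M"
proof -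
  have "continuous_on UNIV (\<lambda>y. \<phi> (- y + x))"
    using assms(2) by (intro continuous_on_compose2[where f="\<lambda>y. - y + x" and t=UNIV and g=\<phi>]
        continuous_intros) (auto simp: Cc_functions_def)
  then show ?thesis
    using borel_measurable_continuous_onI borel_measurable_left_haar_iff[OF assms(1)] by blast
qed

text \<open>
  By left invariance, translating the argument of a convolution translates its left factor. The
  substitution is an identity of Bochner integrals that persists when they do not converge, both
  sides then having the default value 0.
\<close>

lemma group_convolution_add_left:
  fixes M :: "'a::{topological_group_add,t2_space} measure"
  assumes M: "left_haar_measure M" and f: "f \<in> borel_measurable M" and \<phi>: "\<phi> \<in> Cc_functions"
  shows "group_convolution M f \<phi> (z + x) = group_convolution M (left_translate z f) \<phi> x"
proof -
  have "(LINT y|M. f y * \<phi> (- y + (z + x)))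
      = (LINT y|distr M M (\<lambda>y. z + y). f y * \<phi> (- y + (z + x)))"
    by (simp add: distr_left_add[OF M])
  also have "\<dots> = (LINT y|M. f (z + y) * \<phi> (- (z + y) + (z + x)))"
    using f borel_measurable_reflected[OF M \<phi>]
    by (intro integral_distr measurable_left_add[OF M]) auto
  also have "\<dots> = (LINT y|M. f (z + y) * \<phi> (- y + x))"
    by (simp add: minus_add add.assoc[symmetric])
  finally show ?thesis by (simp add: group_convolution_def left_translate_def)
qed

section \<open>Equicontinuity of the convolutions\<close>

text \<open>
  Once the translation has been moved to \<open>f\<close>, the test function \<open>y \<mapsto> \<phi> (- y + x)\<close> no longer varies.
  A bound for it and the measure of its support give a constant that is chosen before \<open>f\<close> and \<open>z\<close>,
  which is what makes the estimate uniform over a family.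
\<close>

lemma group_convolution_translate_bound:
  fixes M :: "'a::{topological_group_add,t2_space} measure"
  assumes M: "left_haar_measure M" and p: "1 \<le> p" and \<phi>: "\<phi> \<in> Cc_functions"
  obtains C where "0 < C"
    "\<And>f z \<delta>. \<lbrakk>f \<in> Lp_functions M p; 0 < \<delta>;
        Lp_norm M p (\<lambda>y. left_translate z f y - f y) \<le> ennreal \<delta>\<rbrakk>
      \<Longrightarrow> cmod (group_convolution M f \<phi> (z + x) - group_convolution M f \<phi> x) \<le> C * \<delta>"
proof -
  obtain B where B: "0 \<le> B" "\<And>y. cmod (\<phi> y) \<le> B"
    using Cc_function_bounded[OF \<phi>] by blast
  obtain K where K: "compact K" "\<And>y. y \<notin> K \<Longrightarrow> \<phi> (- y + x) = 0"
    using Cc_function_reflected_support[OF \<phi>] by blast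
  have Ks: "K \<in> sets M" and Kfin: "emeasure M K < \<infinity>"
    using M K(1) by (auto simp: left_haar_measure_def borel_compact)
  define \<psi> where "\<psi> y = \<phi> (- y + x)" for y
  have \<psi>[measurable]: "\<psi> \<in> borel_measurable M"
    using borel_measurable_reflected[OF M \<phi>] by (simp add: \<psi>_def[abs_def])
  have \<psi>_off: "\<psi> y = 0" if "y \<notin> K" for y using K(2) that by (simp add: \<psi>_def)
  have \<psi>_bd: "cmod (\<psi> y) \<le> B" for y using B(2) by (simp add: \<psi>_def)
  \<comment> \<open>Enlarging \<open>B\<close> by 1 keeps the constant positive when \<open>\<phi>\<close> vanishes.\<close>
  define C where "C = (B + 1) * (measure M K + 1)"
  show thesis
  proof (rule that[of C])
    show "0 < C" using B(1) by (simp add: C_def add_nonneg_pos)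
    fix f z and \<delta> :: real
    assume f: "f \<in> Lp_functions M p" and \<delta>: "0 < \<delta>"
      and norm: "Lp_norm M p (\<lambda>y. left_translate z f y - f y) \<le> ennreal \<delta>"
    define g where "g y = left_translate z f y - f y" for y
    have fm[measurable]: "f \<in> borel_measurable M" using f by (simp add: Lp_functions_def)
    have "left_translate z f \<in> borel_measurable M"
      unfolding left_translate_def using measurable_compose[OF measurable_left_add[OF M] fm] .
    then have gm[measurable]: "g \<in> borel_measurable M"
      unfolding g_def[abs_def] by measurable
    have norm': "Lp_norm M p g \<le> ennreal \<delta>"
      using norm by (simp add: g_def[abs_def])
    have int_f: "integrable M (\<lambda>y. f y * \<psi> y)"
      using f by (intro integrable_mult_of_Lp_norm_finite[OF p B(1) fm \<psi> Ks Kfin _ \<psi>_bd \<psi>_off])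
        (auto simp: Lp_functions_def)
    have int_g: "integrable M (\<lambda>y. g y * \<psi> y)"
      using le_less_trans[OF norm' ennreal_less_top]
      by (intro integrable_mult_of_Lp_norm_finite[OF p B(1) gm \<psi> Ks Kfin _ \<psi>_bd \<psi>_off]) auto
    have "group_convolution M f \<phi> (z + x) = (LINT y|M. g y * \<psi> y + f y * \<psi> y)"
      unfolding group_convolution_add_left[OF M fm \<phi>]
      by (simp add: group_convolution_def g_def \<psi>_def algebra_simps)
    also have "\<dots> = (LINT y|M. g y * \<psi> y) + group_convolution M f \<phi> x"
      using int_f int_g by (simp add: group_convolution_def \<psi>_def)
    finally have "ennreal (cmod (group_convolution M f \<phi> (z + x) - group_convolution M f \<phi> x))
        = ennreal (cmod (LINT y|M. g y * \<psi> y))"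
      by simp
    also have "\<dots> \<le> (\<integral>\<^sup>+ y. ennreal (cmod (g y * \<psi> y)) \<partial>M)"
      using integral_norm_bound_ennreal[OF int_g] by simp
    also have "\<dots> \<le> ennreal (B * \<delta>) * (emeasure M K + 1)"
      by (rule nn_integral_mult_le_Lp_norm[OF p \<delta> B(1) gm Ks norm' \<psi>_bd \<psi>_off])
    also have "emeasure M K + 1 = ennreal (measure M K + 1)"
      using Kfin by (simp add: emeasure_eq_ennreal_measure less_top ennreal_plus)
    also have "ennreal (B * \<delta>) * ennreal (measure M K + 1) = ennreal (B * \<delta> * (measure M K + 1))"
      using B(1) \<delta> by (intro ennreal_mult[symmetric]) auto
    also have "\<dots> \<le> ennreal (C * \<delta>)"
      using \<delta> by (intro ennreal_leI) (simp add: C_def algebra_simps)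
    finally show "cmod (group_convolution M f \<phi> (z + x) - group_convolution M f \<phi> x) \<le> C * \<delta>"
      using \<open>0 < C\<close> \<delta> by (simp add: ennreal_le_iff)
  qed
qed

theorem theorem7:
  fixes M :: "'a::{topological_group_add,t2_space} measure"
    and p :: real
    and F :: "('a \<Rightarrow> complex) set"
    and \<phi> :: "'a \<Rightarrow> complex"
  assumes "locally_compact_space (euclidean :: 'a topology)"
    and "left_haar_measure M"
    and "1 \<le> p"
    and "F \<subseteq> Lp_functions M p"
    and "Lp_equicontinuous M p F"
    and "\<phi> \<in> Cc_functions"
  shows "equicontinuous_family ((\<lambda>f. group_convolution M f \<phi>) ` F)"
  unfolding equicontinuous_family_def
proof (intro allI impI)
  fix x0 :: 'a and \<epsilon> :: real assume \<epsilon>: "0 < \<epsilon>"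
  obtain C where C: "0 < C"
    "\<And>f z \<delta>. \<lbrakk>f \<in> Lp_functions M p; 0 < \<delta>;
        Lp_norm M p (\<lambda>y. left_translate z f y - f y) \<le> ennreal \<delta>\<rbrakk>
      \<Longrightarrow> cmod (group_convolution M f \<phi> (z + x0) - group_convolution M f \<phi> x0) \<le> C * \<delta>"
    using group_convolution_translate_bound[OF assms(2,3,6)] by blast
  have \<delta>: "0 < \<epsilon> / C" using \<epsilon> C(1) by simp
  obtain U where U: "open U" "0 \<in> U"
    "\<And>f. f \<in> F \<Longrightarrow> (SUP z\<in>U. Lp_norm M p (\<lambda>y. left_translate z f y - f y)) \<le> ennreal (\<epsilon> / C)"
    using assms(5) \<delta> unfolding Lp_equicontinuous_def by meson
  \<comment> \<open>The right translate of \<open>U\<close> by \<open>x0\<close>: its points are the \<open>z + x0\<close> with \<open>z\<close> in \<open>U\<close>.\<close>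
  let ?V = "(\<lambda>x. x - x0) -` U"
  have "open ?V"
    using U(1) by (intro open_vimage continuous_intros)
  moreover have "x0 \<in> ?V" using U(2) by simp
  moreover have "cmod (group_convolution M f \<phi> x - group_convolution M f \<phi> x0) \<le> \<epsilon>"
    if x: "x \<in> ?V" and f: "f \<in> F" for x f
  proof -
    have "Lp_norm M p (\<lambda>y. left_translate (x - x0) f y - f y) \<le> ennreal (\<epsilon> / C)"
      using U(3)[OF f] x by (auto simp: SUP_le_iff)
    then have "cmod (group_convolution M f \<phi> (x - x0 + x0) - group_convolution M f \<phi> x0)
        \<le> C * (\<epsilon> / C)"
      using C(2) f assms(4) \<delta> by blast
    then show ?thesis using C(1) by simp
  qed
  ultimately show "\<exists>U. open U \<and> x0 \<in> U \<and>
      (\<forall>x\<in>U. \<forall>h\<in>(\<lambda>f. group_convolution M f \<phi>) ` F. cmod (h x - h x0) \<le> \<epsilon>)"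
    by blast
qed

end
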